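(* Let $M$ be a positive integer. Then $$ \frac{1-q^M}{1-wq^M}\,\frac{1}{(q;q^8)_\infty (q^4;q^8)_\infty (q^7;q^8)_\infty} =1+\frac{q[M-1]_q+wq^M}{1-wq^M} +\sum_{j=2}^\infty q^{j^2}\,\frac{[M]_{q}}{1-wq^M}\,\frac{(-q^3;q^2)_{j-1}}{(q^4;q^2)_{j-1}}. $$
   Context: Here $w$ is an indeterminate and the identity is one of formal power series in $q$ with coefficients polynomial in $w$. Notation: $(A;p)_k=\prod_{i=0}^{k-1}(1-Ap^i)$, $(A;p)_\infty=\prod_{i\ge0}(1-Ap^i)$, and $[M]_q=\frac{1-q^M}{1-q}$ (so $[0]_q=0$). *)

theory Defs
  imports "HOL-Analysis.Analysis" "HOL-Computational_Algebra.Polynomial"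
begin

text \<open>
  The ambient ring is \<^typ>\<open>'a poly fps\<close>, i.e. \<open>R[w][[q]]\<close> for an arbitrary commutative ring \<open>R\<close>,
  with its usual \<open>q\<close>-adic topology (the metric on \<^type>\<open>fps\<close>); infinite products and series are
  taken in that topology.
\<close>

abbreviation q :: "'a::comm_ring_1 poly fps" where
  "q \<equiv> fps_X"

abbreviation w :: "'a::comm_ring_1 poly fps" where
  "w \<equiv> fps_const [:0, 1:]"

text \<open>
  The division of \<^type>\<open>fps\<close> needs coefficients with an \<^const>\<open>inverse\<close> operation, which polynomials
  do not have. All denominators below have constant coefficient \<open>1\<close> and are therefore units;
  the lemmas following the definition show that in this case it is the true quotient.
\<close>

definition fps_quot :: "'a::comm_ring_1 fps \<Rightarrow> 'a fps \<Rightarrow> 'a fps"  (infixl \<open>\<div>\<close> 70) where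
  "f \<div> g = f * fps_right_inverse g 1"

lemma fps_quot_mult:
  assumes "fps_nth g 0 = 1"
  shows "(f \<div> g) * g = f"
  using fps_right_inverse[of g 1] assms
  by (simp add: fps_quot_def mult.assoc mult.commute[of "fps_right_inverse g 1" g])

lemma fps_quot_unique:
  assumes "fps_nth g 0 = 1" and "h * g = f"
  shows "f \<div> g = h"
  using fps_right_inverse[of g 1] assms
  by (auto simp: fps_quot_def mult.assoc)

definition qpoch :: "'a::comm_ring_1 \<Rightarrow> 'a \<Rightarrow> nat \<Rightarrow> 'a" where
  "qpoch A p k = (\<Prod>i<k. 1 - A * p ^ i)"

definition qpoch_inf :: "'a::{t2_space, comm_ring_1} \<Rightarrow> 'a \<Rightarrow> 'a" where
  "qpoch_inf A p = (\<Prod>i. 1 - A * p ^ i)"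

definition qnum :: "nat \<Rightarrow> 'a::comm_ring_1 poly fps" where
  "qnum M = (1 - q ^ M) \<div> (1 - q)"

text \<open>
  \<^const>\<open>prodinf\<close> and \<^const>\<open>suminf\<close> are only meaningful for convergent products and series.
  The following lemmas establish this for those used here.
\<close>

lemma qpoch_nth_0:
  fixes A p :: "'a::comm_ring_1 fps"
  assumes "fps_nth A 0 = 0"
  shows "fps_nth (qpoch A p k) 0 = 1"
  using assms by (induction k) (simp_all add: qpoch_def)

lemma qpoch_stable:
  fixes A p :: "'a::comm_ring_1 fps"
  assumes "fps_nth p 0 = 0" and "n < k"
  shows "fps_nth (qpoch A p k) n = fps_nth (qpoch A p (Suc n)) n"
  using \<open>n < k\<close>
proof (induction k)
  case (Suc k)
  show ?case
  proof (cases "k = n")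
    case False
    with Suc.prems have "n < k" by simp
    have "fps_nth (p ^ k * (qpoch A p k * A)) n = 0"
      unfolding fps_mult_nth
      using startsby_zero_power_prefix[OF assms(1)] \<open>n < k\<close> by (intro sum.neutral) auto
    moreover have "qpoch A p (Suc k) = qpoch A p k - p ^ k * (qpoch A p k * A)"
      by (simp add: qpoch_def algebra_simps)
    ultimately show ?thesis
      using Suc.IH[OF \<open>n < k\<close>] by simp
  qed simp
qed simp

lemma qpoch_LIMSEQ:
  fixes A p :: "'a::comm_ring_1 fps"
  assumes "fps_nth p 0 = 0"
  shows "qpoch A p \<longlonglongrightarrow> Abs_fps (\<lambda>n. fps_nth (qpoch A p (Suc n)) n)"
  unfolding tendsto_fps_iff
proof
  fix n
  have "\<forall>\<^sub>F k in sequentially. fps_nth (qpoch A p k) n = fps_nth (qpoch A p (Suc n)) n"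
    using eventually_gt_at_top[of n] by eventually_elim (rule qpoch_stable[OF assms])
  then show "\<forall>\<^sub>F k in sequentially. fps_nth (qpoch A p k) n =
      fps_nth (Abs_fps (\<lambda>n. fps_nth (qpoch A p (Suc n)) n)) n"
    by simp
qed

lemma qpoch_has_prod:
  fixes A p :: "'a::comm_ring_1 fps"
  assumes "fps_nth A 0 = 0" and "fps_nth p 0 = 0"
  shows "(\<lambda>i. 1 - A * p ^ i) has_prod Abs_fps (\<lambda>n. fps_nth (qpoch A p (Suc n)) n)"
    (is "_ has_prod ?L")
proof -
  have "fps_nth ?L 0 = 1"
    using qpoch_nth_0[OF assms(1)] by simp
  then have "?L \<noteq> 0" by (metis fps_zero_nth zero_neq_one)
  moreover have "(\<lambda>n. qpoch A p (Suc n)) \<longlonglongrightarrow> ?L"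
    by (rule LIMSEQ_Suc[OF qpoch_LIMSEQ[OF assms(2)]])
  ultimately show ?thesis
    by (simp add: has_prod_def raw_has_prod_def qpoch_def lessThan_Suc_atMost)
qed

lemma qpoch_tendsto_qpoch_inf:
  fixes A p :: "'a::comm_ring_1 fps"
  assumes "fps_nth A 0 = 0" and "fps_nth p 0 = 0"
  shows "qpoch A p \<longlonglongrightarrow> qpoch_inf A p"
proof -
  let ?f = "\<lambda>i. 1 - A * p ^ i"
  let ?L = "Abs_fps (\<lambda>n. fps_nth (qpoch A p (Suc n)) n)"
  have nz: "?f i \<noteq> 0" for i
  proof
    assume "?f i = 0"
    then have "fps_nth (?f i) 0 = 0" by simp
    with assms(1) show False by simp
  qed
  have lim: "(\<lambda>n. \<Prod>i\<le>n. ?f i) \<longlonglongrightarrow> ?L"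
    using LIMSEQ_Suc[OF qpoch_LIMSEQ[OF assms(2)]] by (simp add: qpoch_def lessThan_Suc_atMost)
  have "qpoch_inf A p = ?L"
    unfolding qpoch_inf_def prodinf_def
  proof (rule the_equality)
    show "?f has_prod ?L" by (rule qpoch_has_prod[OF assms])
  next
    fix p' assume "?f has_prod p'"
    with nz have "(\<lambda>n. \<Prod>i\<le>n. ?f i) \<longlonglongrightarrow> p'"
      by (auto simp: has_prod_def raw_has_prod_def)
    then show "p' = ?L" using lim LIMSEQ_unique by blast
  qed
  with qpoch_LIMSEQ[OF assms(2)] show ?thesis by simp
qed

lemma summable_fps_X_power:
  fixes f :: "nat \<Rightarrow> 'a::comm_ring_1 fps"
  shows "summable (\<lambda>j. fps_X ^ ((j + 2)\<^sup>2) * f j)"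
proof -
  let ?t = "\<lambda>j. fps_X ^ ((j + 2)\<^sup>2) * f j"
  let ?L = "Abs_fps (\<lambda>n. fps_nth (\<Sum>j<n. ?t j) n)"
  have stable: "fps_nth (\<Sum>j<k. ?t j) n = fps_nth (\<Sum>j<n. ?t j) n" if "n \<le> k" for n k
  proof -
    have "fps_nth (?t j) n = 0" if "n \<le> j" for j
    proof -
      have "n < (j + 2)\<^sup>2" using that by (simp add: power2_eq_square)
      then show ?thesis by (simp add: fps_X_power_mult_nth)
    qed
    then have "(\<Sum>j<k. fps_nth (?t j) n) = (\<Sum>j<n. fps_nth (?t j) n)"
      using that by (intro sum.mono_neutral_right) auto
    then show ?thesis by (simp add: fps_sum_nth)
  qed
  have "(\<lambda>k. \<Sum>j<k. ?t j) \<longlonglongrightarrow> ?L"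
    unfolding tendsto_fps_iff
  proof
    fix n
    show "\<forall>\<^sub>F k in sequentially. fps_nth (\<Sum>j<k. ?t j) n = fps_nth ?L n"
      using eventually_ge_at_top[of n] by eventually_elim (unfold fps_nth_Abs_fps, rule stable)
  qed
  then show ?thesis by (auto simp: summable_def sums_def)
qed

end

theory Submission
  imports Defs
begin

text \<open>
  Clearing the factor \<open>1 / (1 - w q^M)\<close> and then the common factor \<open>(1 - q^M) / (1 - q)\<close> leaves an
  identity without \<open>w\<close> and \<open>M\<close>. Since
  \<open>(1 - q) (-q; q^2)_j / (q^2; q^2)_j = (-q^3; q^2)_(j-1) / (q^4; q^2)_(j-1)\<close> for \<open>j \<ge> 1\<close>, it is
  \<open>1 - q\<close> times the first Goellnitz--Gordon identity
  \<open>\<Sum>n. q^(n^2) (-q; q^2)_n / (q^2; q^2)_n = 1 / ((q; q^8)_\<infinity> (q^4; q^8)_\<infinity> (q^7; q^8)_\<infinity>)\<close>,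
  whose terms \<open>n = 0\<close> and \<open>n = 1\<close> add up to \<open>1 / (1 - q)\<close>.

  The Goellnitz--Gordon identity is proved by a Bailey chain. The finite Jacobi triple product
  provides, for every factorisation \<open>y z = p\<close>, a Bailey pair relative to \<open>1\<close> in base \<open>p\<close>. For
  \<open>z = 1\<close> its \<open>\<beta>\<close> vanishes at all \<open>n > 0\<close>, so that one application of Bailey's lemma gives a pair with
  \<open>\<beta> n = 1 / (p; p)_n\<close>. A second application with \<open>p = q^2\<close>, whose free parameter is chosen to produce
  the factor \<open>(-q; q^2)_n\<close>, is a finite form of the identity. As \<open>N \<rightarrow> \<infinity>\<close> the left-hand side becomes
  the Goellnitz--Gordon series and the right-hand side a theta series, which the Jacobi triple
  product in base \<open>q^8\<close> (the limit of the same finite identity, with \<open>y = q^5\<close> and \<open>z = q^3\<close>) turns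
  into a product.

  Bailey's lemma and the finite triple product both reduce to Pascal's rule for Gaussian
  binomial coefficients, applied term by term. These steps are polynomial identities, so they
  hold over every commutative ring; reciprocals enter only as inverses of power series with constant
  coefficient \<open>1\<close>.
\<close>

section \<open>Gaussian binomial coefficients and the q-Vandermonde sum\<close>

lemma qpoch_0 [simp]: "qpoch A p 0 = 1"
  by (simp add: qpoch_def)

lemma qpoch_Suc: "qpoch A p (Suc k) = qpoch A p k * (1 - A * p ^ k)"
  by (simp add: qpoch_def)

lemma qpoch_add: "qpoch A p (k + m) = qpoch A p k * qpoch (A * p ^ k) p m"
  by (induction m) (simp_all add: qpoch_Suc power_add mult.assoc)

lemma qpoch_Suc_left: "qpoch A p (Suc k) = (1 - A) * qpoch (A * p) p k"
  using qpoch_add[of A p 1 k] by (simp add: qpoch_Suc)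

lemma qpoch_one: "k > 0 \<Longrightarrow> qpoch 1 p k = 0"
  by (cases k) (simp_all add: qpoch_Suc_left)

fun qbinom :: "'a::comm_ring_1 \<Rightarrow> nat \<Rightarrow> nat \<Rightarrow> 'a" where
  "qbinom p n 0 = 1"
| "qbinom p 0 (Suc k) = 0"
| "qbinom p (Suc n) (Suc k) = qbinom p n k + p ^ Suc k * qbinom p n (Suc k)"

lemma qbinom_eq_0: "n < k \<Longrightarrow> qbinom p n k = 0"
  by (induction p n k rule: qbinom.induct) auto

text \<open>
  The quotient formula for the Gaussian binomial coefficient, cleared of denominators because
  \<open>qpoch p p k\<close> need not be invertible in a general ring.
\<close>

lemma qbinom_mult_qpoch: "qbinom p (k + m) k * qpoch p p k * qpoch p p m = qpoch p p (k + m)"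
proof (induction "k + m" arbitrary: k m)
  case (Suc n)
  show ?case
  proof (cases k)
    case [simp]: (Suc k')
    show ?thesis
    proof (cases m)
      case 0
      have "qbinom p k' k' * qpoch p p k' = qpoch p p k'"
        using Suc.hyps(1)[of k' 0] Suc.hyps(2) 0 by simp
      then show ?thesis using 0 by (simp add: qbinom_eq_0 qpoch_Suc mult.assoc [symmetric])
    next
      case [simp]: (Suc m')
      have 1: "qbinom p (k' + m) k' * qpoch p p k' * qpoch p p m = qpoch p p n"
        and 2: "qbinom p (k + m') k * qpoch p p k * qpoch p p m' = qpoch p p n"
        using Suc.hyps(1)[of k' m] Suc.hyps(1)[of k m'] Suc.hyps(2) by auto
      have n: "n = k' + m" "n = k + m'" using Suc.hyps(2) by auto
      have "qbinom p (k + m) k * qpoch p p k * qpoch p p m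
          = (1 - p ^ k) * (qbinom p n k' * qpoch p p k' * qpoch p p m)
            + p ^ k * (1 - p ^ m) * (qbinom p n k * qpoch p p k * qpoch p p m')"
        using n by (simp add: qpoch_Suc algebra_simps)
      also have "\<dots> = (1 - p ^ k * p ^ m) * qpoch p p n"
        unfolding n(1) unfolding 1 unfolding n(1)[symmetric] unfolding n(2) 2
        unfolding n(2)[symmetric] by (simp add: algebra_simps)
      also have "\<dots> = qpoch p p (k + m)"
        using n by (simp add: qpoch_Suc power_add algebra_simps)
      finally show ?thesis .
    qed
  qed simp
qed simp

text \<open>
  Pascal's rule in summed form: it moves one step of \<open>n\<close> from the binomial coefficient to the
  weight \<open>f\<close>. Every induction over a sum of Gaussian binomials below rests on it.
\<close>

lemma sum_qbinom_Suc:
  "(\<Sum>k\<le>Suc n. qbinom p (Suc n) k * f k) = (\<Sum>k\<le>n. qbinom p n k * (p ^ k * f k + f (Suc k)))"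
proof -
  have "(\<Sum>k\<le>n. qbinom p n k * (p ^ k * f k)) = (\<Sum>k\<le>Suc n. qbinom p n k * (p ^ k * f k))"
    by (simp add: qbinom_eq_0)
  also have "\<dots> = f 0 + (\<Sum>k\<le>n. qbinom p n (Suc k) * (p ^ Suc k * f (Suc k)))"
    by (subst sum.atMost_Suc_shift) simp
  finally show ?thesis
    by (subst sum.atMost_Suc_shift) (simp add: algebra_simps sum.distrib)
qed

text \<open>
  The q-Chu--Vandermonde sum of a terminating \<open>2\<phi>1\<close> series, usually written with parameters \<open>A\<close>
  and \<open>C = A B\<close> and summand \<open>(-B)^m p^(m choose 2) (A)_m\<close>. Multiplying out \<open>A\<close> makes it division-free
  and admits \<open>B = 0\<close> and \<open>C = 0\<close>, both of which are needed. After Pascal's rule the two contributions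
  to a summand for \<open>M + 1\<close> share a factor, and the cofactors add up to
  \<open>(1 - C p^m) + (C p^m - B) = 1 - B\<close>; what remains is the summand for \<open>M\<close> with \<open>B\<close> and \<open>C\<close> replaced
  by \<open>B p\<close> and \<open>C p\<close>.
\<close>

lemma q_Vandermonde:
  "(\<Sum>m\<le>M. qbinom p M m * ((\<Prod>i<m. C * p ^ (2 * i) - B * p ^ i) * qpoch (C * p ^ m) p (M - m)))
    = qpoch B p M"
proof (induction M arbitrary: B C)
  case (Suc M)
  let ?P = "\<lambda>B C m. \<Prod>i<m. C * p ^ (2 * i) - B * p ^ i"
  have "(\<Sum>m\<le>Suc M. qbinom p (Suc M) m * (?P B C m * qpoch (C * p ^ m) p (Suc M - m)))
      = (\<Sum>m\<le>M. qbinom p M m * (p ^ m * (?P B C m * qpoch (C * p ^ m) p (Suc M - m))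
          + ?P B C (Suc m) * qpoch (C * p ^ Suc m) p (Suc M - Suc m)))"
    by (rule sum_qbinom_Suc)
  also have "\<dots> = (\<Sum>m\<le>M. (1 - B) * (qbinom p M m *
      (?P (B * p) (C * p) m * qpoch (C * p * p ^ m) p (M - m))))"
  proof (rule sum.cong, goal_cases)
    case (2 m)
    then have m: "Suc M - m = Suc (M - m)" by auto
    have "?P (B * p) (C * p) m = p ^ m * ?P B C m"
      by (induction m) (simp_all add: algebra_simps)
    moreover have "?P B C (Suc m) = ?P B C m * (p ^ m * (C * p ^ m - B))"
      by (simp add: algebra_simps mult_2_right power_add)
    ultimately show ?case
      unfolding m qpoch_Suc_left by (simp add: algebra_simps)
  qed simp
  also have "\<dots> = (1 - B) * qpoch (B * p) p M"
    by (simp only: sum_distrib_left[symmetric] Suc.IH)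
  finally show ?case by (simp add: qpoch_Suc_left)
qed simp

section \<open>The finite Jacobi triple product\<close>

definition theta_coeff :: "'a::comm_ring_1 \<Rightarrow> 'a \<Rightarrow> nat \<Rightarrow> 'a" where
  "theta_coeff p z r = (-1) ^ r * p ^ (r choose 2) * z ^ r"

lemma theta_coeff_0 [simp]: "theta_coeff p z 0 = 1"
  by (simp add: theta_coeff_def numeral_2_eq_2)

lemma theta_coeff_Suc: "theta_coeff p z (Suc r) = - (p ^ r * z * theta_coeff p z r)"
  by (simp add: theta_coeff_def numeral_2_eq_2 power_add algebra_simps)

lemma q_binomial_theorem:
  "(\<Sum>k\<le>m. qbinom p m k * theta_coeff p z k) = qpoch z p m"
proof -
  have "(\<Prod>i<k. 0 * p ^ (2 * i) - z * p ^ i) = theta_coeff p z k" for k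
    by (induction k) (simp_all add: theta_coeff_Suc algebra_simps)
  moreover have "qpoch 0 p k = 1" for k
    by (simp add: qpoch_def)
  ultimately show ?thesis
    using q_Vandermonde[of p m 0 z] by simp
qed

text \<open>
  In terms of \<open>r = k - n\<close> the weight is \<open>(-1)^r p^(r(r-1)/2) z^r\<close>, where \<open>y = p / z\<close> keeps all powers
  nonnegative when \<open>r < 0\<close>. With \<open>n = 0\<close> this is the q-binomial theorem. Raising \<open>n\<close> by one shifts
  the index by one. Of the two weights in Pascal's rule, the one with the shifted index is the old
  weight and the other, multiplied by \<open>p^k\<close>, is \<open>- y p^n\<close> times the old weight; the sum is therefore
  multiplied by \<open>1 - y p^n\<close>.
\<close>

lemma finite_Jacobi_triple_product:
  assumes "y * z = p"
  shows "(\<Sum>k\<le>m + n. qbinom p (m + n) k *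
      (if n \<le> k then theta_coeff p z (k - n) else theta_coeff p y (n - k))) = qpoch z p m * qpoch y p n"
proof (induction n)
  case 0
  show ?case using q_binomial_theorem[of p m z] by simp
next
  case (Suc n)
  define c where "c = (\<lambda>n k. if n \<le> k then theta_coeff p z (k - n) else theta_coeff p y (n - k))"
  have shift: "c (Suc n) (Suc k) = c n k" for k
    by (simp add: c_def)
  \<comment> \<open>The weights obey different recursions right and left of index \<open>n\<close>, and \<open>y z = p\<close> reconciles them.\<close>
  have step: "p ^ k * c (Suc n) k = - (y * p ^ n) * c n k" for k
  proof (cases "n < k")
    case True
    then obtain r where k: "k = Suc (n + r)" by (auto simp: less_iff_Suc_add)
    show ?thesis unfolding k
      by (simp add: c_def theta_coeff_Suc power_add assms[symmetric] algebra_simps)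
  next
    case False
    then obtain r where n: "n = k + r" by (auto simp: not_less le_iff_add)
    show ?thesis unfolding n
      by (cases r) (simp_all add: c_def Suc_diff_le theta_coeff_Suc power_add algebra_simps)
  qed
  have "(\<Sum>k\<le>m + Suc n. qbinom p (m + Suc n) k * c (Suc n) k)
      = (\<Sum>k\<le>m + n. qbinom p (m + n) k * (p ^ k * c (Suc n) k + c (Suc n) (Suc k)))"
    using sum_qbinom_Suc[of p "m + n" "c (Suc n)"] by simp
  also have "\<dots> = (1 - y * p ^ n) * (\<Sum>k\<le>m + n. qbinom p (m + n) k * c n k)"
    by (simp add: shift step sum_distrib_left algebra_simps)
  also have "\<dots> = qpoch z p m * qpoch y p (Suc n)"
    using Suc.IH by (simp add: c_def qpoch_Suc algebra_simps)
  finally show ?case by (simp add: c_def)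
qed

section \<open>Bailey pairs and Bailey's lemma\<close>

lemma sum_triangle_swap:
  "(\<Sum>n\<le>N. \<Sum>r\<le>n. a n r) = (\<Sum>r\<le>N. \<Sum>n=r..N. a n r)" for N :: nat
proof -
  have "(\<Sum>n\<le>N. \<Sum>r | r \<in> {..N} \<and> r \<le> n. a n r) = (\<Sum>r\<le>N. \<Sum>n | n \<in> {..N} \<and> r \<le> n. a n r)"
    by (rule sum.swap_restrict) auto
  moreover have "{r \<in> {..N}. r \<le> n} = {..n}" if "n \<le> N" for n
    using that by auto
  moreover have "{n \<in> {..N}. r \<le> n} = {r..N}" for r
    by auto
  ultimately show ?thesis by simp
qed

lemma sum_centred:
  "n \<le> N \<Longrightarrow> (\<Sum>r\<le>n. if r = 0 then f N else f (N - r) + f (N + r)) = (\<Sum>k=N-n..N+n. f k)"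
  for n N :: nat and f :: "nat \<Rightarrow> 'a::comm_monoid_add"
proof (induction n)
  case (Suc n)
  then have "{N - Suc n..N + Suc n} = insert (N - Suc n) (insert (N + Suc n) {N - n..N + n})"
    by auto
  moreover have "N - Suc n \<notin> insert (N + Suc n) {N - n..N + n}"
    using Suc.prems by auto
  moreover have "N + Suc n \<notin> {N - n..N + n}"
    by auto
  ultimately have "(\<Sum>k=N-Suc n..N+Suc n. f k) = f (N - Suc n) + (f (N + Suc n) + (\<Sum>k=N-n..N+n. f k))"
    by (simp only: sum.insert finite.insertI finite_atLeastAtMost not_False_eq_True)
  with Suc show ?case by (simp add: add_ac)
qed simp

definition recip_qpoch :: "'a::comm_ring_1 fps \<Rightarrow> nat \<Rightarrow> 'a fps" where
  "recip_qpoch p n = 1 \<div> qpoch p p n"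

lemma recip_qpoch_mult:
  assumes "fps_nth p 0 = 0"
  shows "recip_qpoch p n * qpoch p p n = 1"
  unfolding recip_qpoch_def using assms by (intro fps_quot_mult qpoch_nth_0)

lemma recip_qpoch_0 [simp]: "recip_qpoch p 0 = 1"
  by (simp add: recip_qpoch_def fps_quot_unique)

lemma qbinom_eq_recip_qpoch:
  assumes p: "fps_nth p 0 = 0"
  shows "qbinom p (k + m) k = qpoch p p (k + m) * recip_qpoch p k * recip_qpoch p m"
proof -
  have "qbinom p (k + m) k = qbinom p (k + m) k * (recip_qpoch p k * qpoch p p k) *
      (recip_qpoch p m * qpoch p p m)"
    using recip_qpoch_mult[OF p] by simp
  also have "\<dots> = (qbinom p (k + m) k * qpoch p p k * qpoch p p m) * recip_qpoch p k * recip_qpoch p m"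
    by (simp add: algebra_simps)
  finally show ?thesis by (simp only: qbinom_mult_qpoch)
qed

lemma recip_qpoch_add:
  assumes p: "fps_nth p 0 = 0"
  shows "recip_qpoch p k = qpoch (p ^ Suc k) p m * recip_qpoch p (k + m)"
proof -
  have "recip_qpoch p k = recip_qpoch p k * (recip_qpoch p (k + m) * qpoch p p (k + m))"
    using recip_qpoch_mult[OF p] by simp
  also have "\<dots> = (recip_qpoch p k * qpoch p p k) * (qpoch (p ^ Suc k) p m * recip_qpoch p (k + m))"
    by (simp add: qpoch_add algebra_simps)
  finally show ?thesis using recip_qpoch_mult[OF p] by simp
qed

text \<open>
  Bailey pairs relative to \<open>a = 1\<close>, for which \<open>(a p; p)_(n+r) = (p; p)_(n+r)\<close>.
\<close>

definition Bailey_pair ::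
    "'a::comm_ring_1 fps \<Rightarrow> (nat \<Rightarrow> 'a fps) \<Rightarrow> (nat \<Rightarrow> 'a fps) \<Rightarrow> bool" where
  "Bailey_pair p \<alpha> \<beta> \<longleftrightarrow>
    (\<forall>n. \<beta> n = (\<Sum>r\<le>n. \<alpha> r * recip_qpoch p (n - r) * recip_qpoch p (n + r)))"

text \<open>
  The inner sum of Bailey's lemma, with the summation index shifted by \<open>r\<close>. It is the q-Vandermonde
  sum with \<open>C = p^(2r+1)\<close> and \<open>B = s p^r\<close>, since then
  \<open>C p^(2i) - B p^i = p^(r+i) (p^(r+i+1) - s)\<close> continues the product over \<open>i < r\<close>.
\<close>

lemma Bailey_sum:
  fixes p s :: "'a::comm_ring_1 fps"
  assumes p: "fps_nth p 0 = 0"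
    and e: "\<And>i. p ^ i * (p ^ Suc i - s) = (1 - s * p ^ i) * e i"
  shows "(\<Sum>m\<le>M. (\<Prod>i<r + m. p ^ i * (p ^ Suc i - s)) * recip_qpoch p (M - m) *
      (recip_qpoch p m * recip_qpoch p (r + m + r))) =
    qpoch s p (r + M) * ((\<Prod>i<r. e i) * (recip_qpoch p M * recip_qpoch p (r + M + r)))"
proof -
  let ?U = "recip_qpoch p" and ?d = "\<lambda>n. \<Prod>i<n. p ^ i * (p ^ Suc i - s)"
  let ?C = "p ^ Suc (2 * r)" and ?B = "s * p ^ r"
  let ?K = "?d r * (?U M * ?U (r + M + r))"
  have dr: "?d r = qpoch s p r * (\<Prod>i<r. e i)"
    by (simp only: e prod.distrib qpoch_def)
  have "?d (r + m) * ?U (M - m) * (?U m * ?U (r + m + r))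
      = ?K * (qbinom p M m * ((\<Prod>i<m. ?C * p ^ (2 * i) - ?B * p ^ i) * qpoch (?C * p ^ m) p (M - m)))"
    if "m \<le> M" for m
  proof -
    have d: "?d (r + m) = ?d r * (\<Prod>i<m. ?C * p ^ (2 * i) - ?B * p ^ i)"
      by (induction m) (simp_all add: power_add algebra_simps mult_2_right)
    have U: "?U (r + m + r) = qpoch (?C * p ^ m) p (M - m) * ?U (r + M + r)"
    proof -
      have "p ^ Suc (r + m + r) = ?C * p ^ m"
        by (simp add: power_add mult_2_right algebra_simps)
      moreover have "r + m + r + (M - m) = r + M + r" using that by simp
      ultimately show ?thesis
        using recip_qpoch_add[OF p, of "r + m + r" "M - m"] by metis
    qed
    have "?U M * qbinom p M m = (?U M * qpoch p p M) * (?U m * ?U (M - m))"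
      using qbinom_eq_recip_qpoch[OF p, of m "M - m"] that by (simp add: algebra_simps)
    then have q: "?U (M - m) * ?U m = ?U M * qbinom p M m"
      using recip_qpoch_mult[OF p, of M] by (simp add: algebra_simps)
    have "?d (r + m) * ?U (M - m) * (?U m * ?U (r + m + r))
        = ?d (r + m) * (?U (M - m) * ?U m) * ?U (r + m + r)"
      by (simp add: algebra_simps)
    then show ?thesis unfolding d U q by (simp add: algebra_simps)
  qed
  then have "(\<Sum>m\<le>M. ?d (r + m) * ?U (M - m) * (?U m * ?U (r + m + r))) = ?K * qpoch ?B p M"
    by (simp add: sum_distrib_left[symmetric] q_Vandermonde)
  then show ?thesis
    by (simp only: dr qpoch_add mult_ac)
qed

text \<open>
  Bailey's lemma with \<open>\<rho>\<^sub>1 \<rightarrow> \<infinity>\<close> and \<open>s = p / \<rho>\<^sub>2\<close>. The usual formulation has the quotient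
  \<open>(\<rho>\<^sub>2)_r / (p / \<rho>\<^sub>2)_r\<close> in front of \<open>\<alpha> r\<close>; the sequence \<open>e\<close> stands for its successive factors, together
  with the powers of \<open>p\<close> and \<open>\<rho>\<^sub>2\<close>. In this form the limit \<open>\<rho>\<^sub>2 \<rightarrow> \<infinity>\<close> is the case \<open>s = 0\<close>.
\<close>

lemma Bailey_lemma:
  fixes p s :: "'a::comm_ring_1 fps"
  assumes p: "fps_nth p 0 = 0"
    and e: "\<And>i. p ^ i * (p ^ Suc i - s) = (1 - s * p ^ i) * e i"
    and pair: "Bailey_pair p \<alpha> \<beta>"
  shows "(\<Sum>n\<le>N. (\<Prod>i<n. p ^ i * (p ^ Suc i - s)) * recip_qpoch p (N - n) * \<beta> n) =
    qpoch s p N * (\<Sum>r\<le>N. (\<Prod>i<r. e i) * \<alpha> r * recip_qpoch p (N - r) * recip_qpoch p (N + r))"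
proof -
  let ?U = "recip_qpoch p" and ?d = "\<lambda>n. \<Prod>i<n. p ^ i * (p ^ Suc i - s)"
  have "(\<Sum>n\<le>N. ?d n * ?U (N - n) * \<beta> n)
      = (\<Sum>n\<le>N. \<Sum>r\<le>n. \<alpha> r * (?d n * ?U (N - n) * (?U (n - r) * ?U (n + r))))"
    using pair by (simp add: Bailey_pair_def sum_distrib_left mult_ac)
  also have "\<dots> = (\<Sum>r\<le>N. \<Sum>n=r..N. \<alpha> r * (?d n * ?U (N - n) * (?U (n - r) * ?U (n + r))))"
    by (rule sum_triangle_swap)
  also have "\<dots> = (\<Sum>r\<le>N. \<alpha> r * (qpoch s p N * ((\<Prod>i<r. e i) * (?U (N - r) * ?U (N + r)))))"
  proof (rule sum.cong, goal_cases)
    case (2 r)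
    then obtain M where N: "N = r + M" by (auto simp: le_iff_add)
    have "(\<Sum>n=r..N. ?d n * ?U (N - n) * (?U (n - r) * ?U (n + r)))
        = (\<Sum>m\<le>M. ?d (r + m) * ?U (M - m) * (?U m * ?U (r + m + r)))"
      unfolding N by (rule sum.reindex_bij_witness[of _ "\<lambda>m. r + m" "\<lambda>n. n - r"])
        (auto simp: add.commute)
    then show ?case
      using Bailey_sum[OF p e, of r M] by (simp add: sum_distrib_left[symmetric] N)
  qed simp
  finally show ?thesis by (simp add: sum_distrib_left algebra_simps)
qed

text \<open>
  The coefficients of a bilateral theta series folded at the origin: the terms of index \<open>r\<close> and \<open>-r\<close>
  are added, and the term of index \<open>0\<close> is counted once.
\<close>

definition sym_theta_coeff :: "'a::comm_ring_1 \<Rightarrow> 'a \<Rightarrow> 'a \<Rightarrow> nat \<Rightarrow> 'a" where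
  "sym_theta_coeff p y z r = (if r = 0 then 1 else theta_coeff p y r + theta_coeff p z r)"

text \<open>
  The finite triple product with \<open>m = n\<close>, divided by \<open>(p; p)_(2n)\<close>: the binomial coefficient with lower
  index \<open>n \<plusminus> r\<close> becomes \<open>1 / ((p; p)_(n-r) (p; p)_(n+r))\<close>.
\<close>

lemma Jacobi_Bailey_pair:
  assumes p: "fps_nth p 0 = 0" and yz: "y * z = p"
  shows "Bailey_pair p (sym_theta_coeff p y z)
    (\<lambda>n. qpoch z p n * qpoch y p n * recip_qpoch p (2 * n))"
  unfolding Bailey_pair_def
proof
  fix n
  let ?U = "recip_qpoch p"
  let ?f = "\<lambda>k. qbinom p (n + n) k *
      (if n \<le> k then theta_coeff p z (k - n) else theta_coeff p y (n - k))"
  have q: "qbinom p (n + n) k = qpoch p p (2 * n) * (?U k * ?U (2 * n - k))" if "k \<le> 2 * n" for k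
    using qbinom_eq_recip_qpoch[OF p, of k "2 * n - k"] that by (simp add: mult_ac mult_2_right)
  have *: "qpoch p p (2 * n) * (sym_theta_coeff p y z r * ?U (n - r) * ?U (n + r)) =
      (if r = 0 then ?f n else ?f (n - r) + ?f (n + r))" if "r \<le> n" for r
    using that by (auto simp: q sym_theta_coeff_def algebra_simps mult_2)
  have "qpoch p p (2 * n) * (\<Sum>r\<le>n. sym_theta_coeff p y z r * ?U (n - r) * ?U (n + r))
      = (\<Sum>r\<le>n. if r = 0 then ?f n else ?f (n - r) + ?f (n + r))"
    unfolding sum_distrib_left by (intro sum.cong refl *) simp
  also have "\<dots> = (\<Sum>k\<le>n + n. ?f k)"
    using sum_centred[of n n ?f] by (simp add: atMost_atLeast0)
  also have "\<dots> = qpoch z p n * qpoch y p n"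
    by (rule finite_Jacobi_triple_product[OF yz])
  finally have "?U (2 * n) * qpoch p p (2 * n) *
      (\<Sum>r\<le>n. sym_theta_coeff p y z r * ?U (n - r) * ?U (n + r)) =
      ?U (2 * n) * (qpoch z p n * qpoch y p n)"
    by (simp only: mult.assoc)
  then show "qpoch z p n * qpoch y p n * ?U (2 * n) =
      (\<Sum>r\<le>n. sym_theta_coeff p y z r * ?U (n - r) * ?U (n + r))"
    by (simp add: recip_qpoch_mult[OF p] mult.commute)
qed

lemma prod_odd_powers: "(\<Prod>i<n. x ^ (2 * i + 1)) = x ^ (n\<^sup>2)" for x :: "'a::comm_ring_1"
  by (induction n) (simp_all add: power2_eq_square power_add mult_2 mult_2_right mult_ac)

text \<open>
  Bailey's lemma with \<open>s = 0\<close> applied to the triple product pair for \<open>y = p\<close>, \<open>z = 1\<close>. As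
  \<open>(1; p)_n = 0\<close> for \<open>n > 0\<close>, only one summand survives on the left. The resulting pair is the one
  behind the Rogers--Ramanujan identities.
\<close>

lemma Slater_Bailey_pair:
  assumes p: "fps_nth p 0 = 0"
  shows "Bailey_pair p (\<lambda>r. p ^ (r\<^sup>2) * sym_theta_coeff p p 1 r) (recip_qpoch p)"
  unfolding Bailey_pair_def
proof
  fix N
  let ?U = "recip_qpoch p" and ?d = "\<lambda>n. \<Prod>i<n. p ^ i * (p ^ Suc i - 0)"
  let ?\<beta> = "\<lambda>n. qpoch 1 p n * qpoch p p n * ?U (2 * n)"
  have e: "p ^ i * (p ^ Suc i - 0) = (1 - 0 * p ^ i) * p ^ (2 * i + 1)" for i
    by (simp add: mult_2_right power_add algebra_simps)
  have "?U N = (\<Sum>n\<in>{0}. ?d n * ?U (N - n) * ?\<beta> n)"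
    by simp
  also have "\<dots> = (\<Sum>n\<le>N. ?d n * ?U (N - n) * ?\<beta> n)"
    by (rule sum.mono_neutral_left) (auto simp: qpoch_one)
  also have "\<dots> = qpoch 0 p N * (\<Sum>r\<le>N. p ^ (r\<^sup>2) *
      sym_theta_coeff p p 1 r * ?U (N - r) * ?U (N + r))"
    using Bailey_lemma[OF p e Jacobi_Bailey_pair[OF p, of p 1], of N] by (simp only: prod_odd_powers mult_1_right)
  finally show "?U N = (\<Sum>r\<le>N. p ^ (r\<^sup>2) * sym_theta_coeff p p 1 r *
      ?U (N - r) * ?U (N + r))"
    by (simp add: qpoch_def)
qed

section \<open>Limits of formal power series\<close>

lemma tendsto_fps_iff_le:
  fixes f :: "'b \<Rightarrow> 'a::group_add fps"
  shows "(f \<longlongrightarrow> a) F \<longleftrightarrow> (\<forall>n. \<forall>\<^sub>F x in F. \<forall>i\<le>n. fps_nth (f x) i = fps_nth a i)"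
proof
  assume f: "(f \<longlongrightarrow> a) F"
  have "\<forall>\<^sub>F x in F. \<forall>i\<in>{..n}. fps_nth (f x) i = fps_nth a i" for n
    using f by (intro eventually_ball_finite) (auto simp: tendsto_fps_iff)
  then show "\<forall>n. \<forall>\<^sub>F x in F. \<forall>i\<le>n. fps_nth (f x) i = fps_nth a i"
    by (simp add: Ball_def)
next
  assume *: "\<forall>n. \<forall>\<^sub>F x in F. \<forall>i\<le>n. fps_nth (f x) i = fps_nth a i"
  show "(f \<longlongrightarrow> a) F"
    unfolding tendsto_fps_iff
  proof
    fix n
    from * have "\<forall>\<^sub>F x in F. \<forall>i\<le>n. fps_nth (f x) i = fps_nth a i" by blast
    then show "\<forall>\<^sub>F x in F. fps_nth (f x) n = fps_nth a n"
      by eventually_elim simp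
  qed
qed

lemma tendsto_fps_mult:
  fixes f g :: "'b \<Rightarrow> 'a::comm_ring_1 fps"
  assumes "(f \<longlongrightarrow> a) F" and "(g \<longlongrightarrow> b) F"
  shows "((\<lambda>x. f x * g x) \<longlongrightarrow> a * b) F"
  unfolding tendsto_fps_iff
proof
  fix n
  have "\<forall>\<^sub>F x in F. \<forall>i\<le>n. fps_nth (f x) i = fps_nth a i"
    and "\<forall>\<^sub>F x in F. \<forall>i\<le>n. fps_nth (g x) i = fps_nth b i"
    using assms by (simp_all add: tendsto_fps_iff_le)
  then show "\<forall>\<^sub>F x in F. fps_nth (f x * g x) n = fps_nth (a * b) n"
    by eventually_elim (auto simp: fps_mult_nth intro!: sum.cong)
qed

lemma tendsto_fps_diff:
  fixes f g :: "'b \<Rightarrow> 'a::comm_ring_1 fps"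
  assumes "(f \<longlongrightarrow> a) F" and "(g \<longlongrightarrow> b) F"
  shows "((\<lambda>x. f x - g x) \<longlongrightarrow> a - b) F"
  unfolding tendsto_fps_iff
proof
  fix n
  have "\<forall>\<^sub>F x in F. fps_nth (f x) n = fps_nth a n" and "\<forall>\<^sub>F x in F. fps_nth (g x) n = fps_nth b n"
    using assms by (simp_all add: tendsto_fps_iff)
  then show "\<forall>\<^sub>F x in F. fps_nth (f x - g x) n = fps_nth (a - b) n"
    by eventually_elim simp
qed

text \<open>
  Continuity of inversion, from \<open>b - g = b g (f - a)\<close> whenever \<open>g f = 1\<close> and \<open>b a = 1\<close>.
\<close>

lemma tendsto_fps_recip:
  fixes f g :: "'b \<Rightarrow> 'a::comm_ring_1 fps"
  assumes f: "(f \<longlongrightarrow> a) F" and g: "\<And>x. g x * f x = 1" and b: "b * a = 1"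
  shows "(g \<longlongrightarrow> b) F"
  unfolding tendsto_fps_iff
proof
  fix n
  have "((\<lambda>x. f x - a) \<longlongrightarrow> a - a) F"
    by (intro tendsto_fps_diff f tendsto_const)
  then have "\<forall>\<^sub>F x in F. \<forall>i\<le>n. fps_nth (f x - a) i = 0"
    by (simp add: tendsto_fps_iff_le)
  then show "\<forall>\<^sub>F x in F. fps_nth (g x) n = fps_nth b n"
  proof eventually_elim
    case (elim x)
    have "b - g x = b * (g x * f x) - (b * a) * g x"
      by (simp add: g b)
    also have "\<dots> = (b * g x) * (f x - a)"
      by (simp add: algebra_simps)
    finally have "fps_nth (b - g x) n = 0"
      using elim by (simp only:) (simp only: fps_mult_nth, intro sum.neutral, simp)
    then show ?case by simp
  qed
qed

lemma qpoch_inf_nth_0: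
  fixes A p :: "'a::comm_ring_1 fps"
  assumes "fps_nth A 0 = 0" and "fps_nth p 0 = 0"
  shows "fps_nth (qpoch_inf A p) 0 = 1"
proof -
  have "\<forall>\<^sub>F k in sequentially. fps_nth (qpoch A p k) 0 = fps_nth (qpoch_inf A p) 0"
    using qpoch_tendsto_qpoch_inf[OF assms] by (simp add: tendsto_fps_iff)
  then show ?thesis
    by (simp add: qpoch_nth_0[OF assms(1)])
qed

lemma recip_qpoch_tendsto:
  fixes p :: "'a::comm_ring_1 fps"
  assumes p: "fps_nth p 0 = 0"
  shows "recip_qpoch p \<longlonglongrightarrow> 1 \<div> qpoch_inf p p"
  using qpoch_tendsto_qpoch_inf[OF p p] recip_qpoch_mult[OF p]
  by (rule tendsto_fps_recip) (intro fps_quot_mult qpoch_inf_nth_0 p)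

text \<open>
  Tannery's theorem for power series. The bound of the order of \<open>f N r\<close> from below by \<open>r\<close>, uniformly
  in \<open>N\<close>, takes the place of a summable majorant: the coefficient of index \<open>n\<close> only sees the summands
  \<open>r \<le> n\<close>.
\<close>

lemma fps_dominated_convergence:
  fixes f :: "nat \<Rightarrow> nat \<Rightarrow> 'a::comm_ring_1 fps"
  assumes lim: "\<And>r. (\<lambda>N. f N r) \<longlonglongrightarrow> g r"
    and small: "\<And>N r n. n < r \<Longrightarrow> fps_nth (f N r) n = 0"
  shows "(\<lambda>N. \<Sum>r\<le>N. f N r) \<longlonglongrightarrow> (\<Sum>r. g r)"
proof -
  let ?L = "Abs_fps (\<lambda>n. \<Sum>r\<le>n. fps_nth (g r) n)"
  have *: "(\<lambda>N. \<Sum>r\<le>N. h N r) \<longlonglongrightarrow> ?L"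
    if lim: "\<And>r. (\<lambda>N. h N r) \<longlonglongrightarrow> g r" and small: "\<And>N r n. n < r \<Longrightarrow> fps_nth (h N r) n = 0"
    for h :: "nat \<Rightarrow> nat \<Rightarrow> 'a fps"
    unfolding tendsto_fps_iff
  proof
    fix n
    have "\<forall>\<^sub>F N in sequentially. \<forall>r\<in>{..n}. fps_nth (h N r) n = fps_nth (g r) n"
      using lim by (intro eventually_ball_finite) (auto simp: tendsto_fps_iff)
    with eventually_ge_at_top[of n]
    show "\<forall>\<^sub>F N in sequentially. fps_nth (\<Sum>r\<le>N. h N r) n = fps_nth ?L n"
    proof eventually_elim
      case (elim N)
      have "(\<Sum>r\<le>N. fps_nth (h N r) n) = (\<Sum>r\<le>n. fps_nth (h N r) n)"
        using elim(1) small by (intro sum.mono_neutral_right) auto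
      then show ?case
        using elim(2) by (simp add: fps_sum_nth)
    qed
  qed
  have "fps_nth (g r) n = 0" if "n < r" for n r
  proof -
    have "\<forall>\<^sub>F N in sequentially. fps_nth (f N r) n = fps_nth (g r) n"
      using lim by (simp add: tendsto_fps_iff)
    then show ?thesis using small[OF that] by simp
  qed
  then have "g sums ?L"
    unfolding sums_def_le by (intro * tendsto_const)
  with *[OF assms] show ?thesis by (simp add: sums_iff)
qed

lemma fps_sums_of_small:
  fixes g :: "nat \<Rightarrow> 'a::comm_ring_1 fps"
  assumes "\<And>r n. n < r \<Longrightarrow> fps_nth (g r) n = 0"
  shows "g sums (\<Sum>r. g r)"
  unfolding sums_def_le using assms by (intro fps_dominated_convergence tendsto_const)

lemma fps_power_mult_nth_eq_0:
  fixes y g :: "'a::comm_ring_1 fps"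
  assumes "fps_nth y 0 = 0" and "n < r"
  shows "fps_nth (y ^ r * g) n = 0"
  unfolding fps_mult_nth
  using startsby_zero_power_prefix[OF assms(1)] assms(2) by (intro sum.neutral) auto

lemma mult_small:
  fixes f g :: "'a::comm_ring_1 fps"
  assumes "\<And>n. n < r \<Longrightarrow> fps_nth f n = 0" and "n < r"
  shows "fps_nth (f * g) n = 0"
  unfolding fps_mult_nth using assms by (intro sum.neutral) auto

lemma LIMSEQ_shift_minus: "f \<longlonglongrightarrow> l \<Longrightarrow> (\<lambda>N. f (N - r)) \<longlonglongrightarrow> l" for f :: "nat \<Rightarrow> 'a::topological_space"
  by (rule LIMSEQ_offset[where k = r]) simp

section \<open>Infinite products\<close>

text \<open>
  The limit of the defining sum of a Bailey pair: both reciprocal factors tend to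
  \<open>1 / (p; p)_\<infinity>\<close>.
\<close>

lemma Bailey_sum_tendsto:
  fixes p :: "'a::comm_ring_1 fps"
  assumes p: "fps_nth p 0 = 0" and small: "\<And>r n. n < r \<Longrightarrow> fps_nth (\<alpha> r) n = 0"
  shows "(\<lambda>N. \<Sum>r\<le>N. \<alpha> r * recip_qpoch p (N - r) * recip_qpoch p (N + r)) \<longlonglongrightarrow>
    (\<Sum>r. \<alpha> r) * (1 \<div> qpoch_inf p p)\<^sup>2"
proof -
  let ?I = "1 \<div> qpoch_inf p p"
  note U = recip_qpoch_tendsto[OF p]
  have "(\<lambda>N. \<Sum>r\<le>N. \<alpha> r * recip_qpoch p (N - r) * recip_qpoch p (N + r)) \<longlonglongrightarrow>
      (\<Sum>r. \<alpha> r * ?I * ?I)"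
    by (intro fps_dominated_convergence tendsto_fps_mult tendsto_const LIMSEQ_shift_minus U
        LIMSEQ_ignore_initial_segment mult_small[OF mult_small[OF small]])
  moreover have "(\<lambda>r. \<alpha> r * ?I * ?I) sums ((\<Sum>r. \<alpha> r) * (?I * ?I))"
    using tendsto_fps_mult[OF fps_sums_of_small[OF small, unfolded sums_def] tendsto_const, where b = "?I * ?I"]
    by (simp add: sums_def sum_distrib_right mult.assoc)
  ultimately show ?thesis by (simp add: sums_iff power2_eq_square)
qed

lemma sym_theta_coeff_small:
  fixes y z :: "'a::comm_ring_1 fps"
  assumes y: "fps_nth y 0 = 0" and z: "fps_nth z 0 = 0" and "n < r"
  shows "fps_nth (sym_theta_coeff p y z r) n = 0"
proof -
  have "sym_theta_coeff p y z r = y ^ r * ((-1) ^ r * p ^ (r choose 2)) + z ^ r * ((-1) ^ r * p ^ (r choose 2))"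
    using assms by (simp add: sym_theta_coeff_def theta_coeff_def mult_ac)
  then show ?thesis
    using fps_power_mult_nth_eq_0[OF y] fps_power_mult_nth_eq_0[OF z] \<open>n < r\<close> by simp
qed

text \<open>
  Both sides of the triple product Bailey pair converge, to \<open>(z; p)_\<infinity> (y; p)_\<infinity> / (p; p)_\<infinity>\<close> and to
  the theta series times \<open>1 / (p; p)_\<infinity>^2\<close>.
\<close>

theorem Jacobi_triple_product:
  fixes y z :: "'a::comm_ring_1 fps"
  assumes y: "fps_nth y 0 = 0" and z: "fps_nth z 0 = 0" and yz: "y * z = p"
  shows "(\<Sum>r. sym_theta_coeff p y z r) = qpoch_inf y p * qpoch_inf z p * qpoch_inf p p"
proof -
  have p: "fps_nth p 0 = 0" using y yz[symmetric] by simp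
  let ?I = "1 \<div> qpoch_inf p p" and ?U = "recip_qpoch p"
  have I: "?I * qpoch_inf p p = 1"
    by (intro fps_quot_mult qpoch_inf_nth_0 p)
  have "(\<lambda>N. ?U (2 * N)) \<longlonglongrightarrow> ?I"
    using LIMSEQ_subseq_LIMSEQ[OF recip_qpoch_tendsto[OF p], of "\<lambda>N. 2 * N"]
    by (simp add: o_def strict_mono_def)
  then have "(\<lambda>N. qpoch z p N * qpoch y p N * ?U (2 * N)) \<longlonglongrightarrow> qpoch_inf z p * qpoch_inf y p * ?I"
    by (intro tendsto_fps_mult qpoch_tendsto_qpoch_inf y z p)
  moreover have "(\<lambda>N. qpoch z p N * qpoch y p N * ?U (2 * N)) \<longlonglongrightarrow>
      (\<Sum>r. sym_theta_coeff p y z r) * ?I\<^sup>2"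
    using Bailey_sum_tendsto[OF p sym_theta_coeff_small[OF y z]] Jacobi_Bailey_pair[OF p yz]
    by (simp add: Bailey_pair_def)
  ultimately have eq: "(\<Sum>r. sym_theta_coeff p y z r) * ?I\<^sup>2 = qpoch_inf z p * qpoch_inf y p * ?I"
    by (rule LIMSEQ_unique[rotated])
  have "(\<Sum>r. sym_theta_coeff p y z r) =
      (\<Sum>r. sym_theta_coeff p y z r) * (?I * qpoch_inf p p)\<^sup>2"
    by (simp add: I)
  also have "\<dots> = ((\<Sum>r. sym_theta_coeff p y z r) * ?I\<^sup>2) * (qpoch_inf p p)\<^sup>2"
    by (simp add: power_mult_distrib mult_ac)
  also have "\<dots> = qpoch_inf z p * qpoch_inf y p * (?I * qpoch_inf p p) * qpoch_inf p p"
    unfolding eq by (simp add: power2_eq_square mult_ac)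
  finally show ?thesis unfolding I by (simp add: mult_ac)
qed

lemma qpoch_inf_dissect:
  fixes A p :: "'a::comm_ring_1 fps"
  assumes A: "fps_nth A 0 = 0" and p: "fps_nth p 0 = 0"
  shows "qpoch_inf A p = qpoch_inf A (p\<^sup>2) * qpoch_inf (A * p) (p\<^sup>2)"
proof -
  have "qpoch A p (2 * N) = qpoch A (p\<^sup>2) N * qpoch (A * p) (p\<^sup>2) N" for N
    by (induction N) (simp_all add: qpoch_Suc mult_ac flip: power_mult)
  then have "(\<lambda>N. qpoch A (p\<^sup>2) N * qpoch (A * p) (p\<^sup>2) N) \<longlonglongrightarrow> qpoch_inf A p"
    using LIMSEQ_subseq_LIMSEQ[OF qpoch_tendsto_qpoch_inf[OF assms], of "\<lambda>N. 2 * N"]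
    by (simp add: o_def strict_mono_def)
  moreover have "(\<lambda>N. qpoch A (p\<^sup>2) N * qpoch (A * p) (p\<^sup>2) N) \<longlonglongrightarrow>
      qpoch_inf A (p\<^sup>2) * qpoch_inf (A * p) (p\<^sup>2)"
    by (intro tendsto_fps_mult qpoch_tendsto_qpoch_inf) (simp_all add: A p power2_eq_square)
  ultimately show ?thesis by (rule LIMSEQ_unique)
qed

lemma qpoch_inf_mult_uminus:
  fixes A p :: "'a::comm_ring_1 fps"
  assumes A: "fps_nth A 0 = 0" and p: "fps_nth p 0 = 0"
  shows "qpoch_inf (- A) p * qpoch_inf A p = qpoch_inf (A\<^sup>2) (p\<^sup>2)"
proof -
  have "(1 + A * p ^ i) * (1 - A * p ^ i) = 1 - A\<^sup>2 * (p\<^sup>2) ^ i" for i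
    by (simp add: algebra_simps power2_eq_square power_mult_distrib)
  then have "qpoch (- A) p N * qpoch A p N = qpoch (A\<^sup>2) (p\<^sup>2) N" for N
    by (simp add: qpoch_def flip: prod.distrib)
  moreover have "(\<lambda>N. qpoch (- A) p N * qpoch A p N) \<longlonglongrightarrow> qpoch_inf (- A) p * qpoch_inf A p"
    by (intro tendsto_fps_mult qpoch_tendsto_qpoch_inf) (simp_all add: A p)
  moreover have "qpoch (A\<^sup>2) (p\<^sup>2) \<longlonglongrightarrow> qpoch_inf (A\<^sup>2) (p\<^sup>2)"
    by (intro qpoch_tendsto_qpoch_inf) (simp_all add: A p power2_eq_square)
  ultimately show ?thesis by (simp add: LIMSEQ_unique)
qed

section \<open>The first Goellnitz--Gordon identity\<close>

text \<open>
  The two Bailey steps contribute \<open>(x^2)^(r^2)\<close> and \<open>x^(r^2)\<close>. Together with the exponent of the initial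
  pair in base \<open>x^2\<close> the total is \<open>4 r^2 \<plusminus> r\<close>, the exponents of the theta series in base \<open>x^8\<close>.
\<close>

lemma Gollnitz_Gordon_theta:
  fixes x :: "'a::comm_ring_1"
  shows "x ^ (r\<^sup>2) * ((x\<^sup>2) ^ (r\<^sup>2) * sym_theta_coeff (x\<^sup>2) (x\<^sup>2) 1 r) =
    sym_theta_coeff (x ^ 8) (x ^ 5) (x ^ 3) r"
proof (cases "r = 0")
  case False
  have r: "r\<^sup>2 = 2 * (r choose 2) + r"
    by (induction r) (simp_all add: power2_eq_square numeral_2_eq_2)
  show ?thesis
    using False unfolding sym_theta_coeff_def theta_coeff_def r
    by (simp add: algebra_simps flip: power_mult power_add)
qed (simp add: sym_theta_coeff_def)

text \<open>
  Splitting \<open>(x; x^2)_\<infinity>\<close> by residues modulo \<open>8\<close> collects the odd factors;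
  \<open>(-x; x^2)_\<infinity> (x; x^2)_\<infinity> = (x^2; x^4)_\<infinity>\<close> and \<open>(x^4; x^4)_\<infinity>\<close> then make up \<open>(x^2; x^2)_\<infinity>\<close>.
\<close>

lemma Gollnitz_Gordon_product:
  fixes x :: "'a::comm_ring_1 fps"
  assumes x: "fps_nth x 0 = 0"
  shows "qpoch_inf (- x) (x\<^sup>2) *
      (qpoch_inf (x ^ 5) (x ^ 8) * qpoch_inf (x ^ 3) (x ^ 8) * qpoch_inf (x ^ 8) (x ^ 8)) *
      (qpoch_inf x (x ^ 8) * qpoch_inf (x ^ 4) (x ^ 8) * qpoch_inf (x ^ 7) (x ^ 8)) =
    qpoch_inf (x\<^sup>2) (x\<^sup>2)"
  (is "?L = _")
proof -
  have 0: "fps_nth (x ^ k) 0 = 0" if "k > 0" for k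
    using startsby_zero_power[OF x that] .
  have odd: "qpoch_inf x (x\<^sup>2) = qpoch_inf x (x ^ 8) * qpoch_inf (x ^ 5) (x ^ 8) *
      (qpoch_inf (x ^ 3) (x ^ 8) * qpoch_inf (x ^ 7) (x ^ 8))"
    using qpoch_inf_dissect[of x "x\<^sup>2"] qpoch_inf_dissect[of x "x ^ 4"] qpoch_inf_dissect[of "x ^ 3" "x ^ 4"]
    by (simp add: x 0 power_Suc[symmetric] del: power_Suc flip: power_mult power_add)
  have four: "qpoch_inf (x ^ 4) (x ^ 4) = qpoch_inf (x ^ 4) (x ^ 8) * qpoch_inf (x ^ 8) (x ^ 8)"
    using qpoch_inf_dissect[of "x ^ 4" "x ^ 4"] by (simp add: 0 flip: power_mult power_add)
  have two: "qpoch_inf (x\<^sup>2) (x\<^sup>2) = qpoch_inf (x\<^sup>2) (x ^ 4) * qpoch_inf (x ^ 4) (x ^ 4)"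
    using qpoch_inf_dissect[of "x\<^sup>2" "x\<^sup>2"] by (simp add: 0 flip: power_mult power_add)
  have neg: "qpoch_inf (- x) (x\<^sup>2) * qpoch_inf x (x\<^sup>2) = qpoch_inf (x\<^sup>2) (x ^ 4)"
    using qpoch_inf_mult_uminus[of x "x\<^sup>2"] by (simp add: x 0 flip: power_mult)
  have "?L = (qpoch_inf (- x) (x\<^sup>2) * qpoch_inf x (x\<^sup>2)) * qpoch_inf (x ^ 4) (x ^ 4)"
    unfolding odd four by (simp only: mult_ac)
  then show ?thesis
    unfolding neg two .
qed

text \<open>
  Bailey's lemma for the pair with \<open>\<beta> n = 1 / (p; p)_n\<close>, in base \<open>p = q^2\<close> and with \<open>s = - q\<close>. For this
  choice \<open>p^i (p^(i+1) - s) = q^(2i+1) (1 + q^(2i+1))\<close>, so the factors \<open>e\<close> are pure powers of \<open>q\<close>.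
  The limit of the resulting finite identity has one more factor \<open>1 / (q^2; q^2)_\<infinity>\<close> on either side,
  which is removed at the end.
\<close>

theorem Gollnitz_Gordon:
  "(\<lambda>n. fps_X ^ (n\<^sup>2) * qpoch (- fps_X) (fps_X\<^sup>2) n * recip_qpoch (fps_X\<^sup>2) n) sums
    (1 \<div> (qpoch_inf fps_X (fps_X ^ 8) * qpoch_inf (fps_X ^ 4) (fps_X ^ 8) *
      qpoch_inf (fps_X ^ 7) (fps_X ^ 8)) :: 'a::comm_ring_1 fps)"
proof -
  let ?q = "fps_X :: 'a fps"
  define p where "p = ?q\<^sup>2"
  define t where "t = (\<lambda>n. ?q ^ (n\<^sup>2) * qpoch (- ?q) p n * recip_qpoch p n)"
  define \<theta> where "\<theta> = sym_theta_coeff (?q ^ 8) (?q ^ 5) (?q ^ 3)"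
  let ?U = "recip_qpoch p" and ?I = "1 \<div> qpoch_inf p p"
  let ?A = "qpoch_inf ?q (?q ^ 8) * qpoch_inf (?q ^ 4) (?q ^ 8) * qpoch_inf (?q ^ 7) (?q ^ 8)"
  have p: "fps_nth p 0 = 0" by (simp add: p_def)
  have I: "?I * qpoch_inf p p = 1"
    by (intro fps_quot_mult qpoch_inf_nth_0 p)
  have small: "fps_nth (?q ^ (r\<^sup>2) * g) n = 0" if "n < r" for r n g
    using less_le_trans[OF that le_square] by (simp add: fps_X_power_mult_nth power2_eq_square)
  have e: "p ^ i * (p ^ Suc i - (- ?q)) = (1 - (- ?q) * p ^ i) * ?q ^ (2 * i + 1)" for i
    by (simp add: p_def power_mult algebra_simps power2_eq_square)
  have d: "(\<Prod>i<n. p ^ i * (p ^ Suc i - (- ?q))) = ?q ^ (n\<^sup>2) * qpoch (- ?q) p n" for n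
    unfolding e prod.distrib prod_odd_powers qpoch_def by (rule mult.commute)
  have t_small: "fps_nth (t r) n = 0" if "n < r" for r n
    unfolding t_def using small[OF that] by (simp add: mult.assoc)
  have \<theta>_small: "fps_nth (\<theta> r) n = 0" if "n < r" for r n
    unfolding \<theta>_def using that by (intro sym_theta_coeff_small) auto
  have finite: "(\<Sum>n\<le>N. t n * ?U (N - n)) = qpoch (- ?q) p N * (\<Sum>r\<le>N. \<theta> r * ?U (N - r) * ?U (N + r))" for N
    using Bailey_lemma[OF p e Slater_Bailey_pair[OF p], of N]
    unfolding d prod_odd_powers Gollnitz_Gordon_theta[of ?q, folded p_def] \<theta>_def[symmetric] t_def
    by (simp add: mult_ac)
  have "(\<lambda>N. \<Sum>n\<le>N. t n * ?U (N - n)) \<longlonglongrightarrow> (\<Sum>n. t n * ?I)"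
    by (intro fps_dominated_convergence tendsto_fps_mult tendsto_const LIMSEQ_shift_minus
        recip_qpoch_tendsto p mult_small[OF t_small])
  moreover have "(\<lambda>n. t n * ?I) sums ((\<Sum>n. t n) * ?I)"
    using tendsto_fps_mult[OF fps_sums_of_small[OF t_small, unfolded sums_def] tendsto_const, where b = "?I"]
    by (simp add: sums_def sum_distrib_right)
  ultimately have "(\<lambda>N. \<Sum>n\<le>N. t n * ?U (N - n)) \<longlonglongrightarrow> (\<Sum>n. t n) * ?I"
    by (simp add: sums_iff)
  moreover have "(\<lambda>N. \<Sum>n\<le>N. t n * ?U (N - n)) \<longlonglongrightarrow> qpoch_inf (- ?q) p * ((\<Sum>r. \<theta> r) * ?I\<^sup>2)"
    unfolding finite
    by (intro tendsto_fps_mult qpoch_tendsto_qpoch_inf p Bailey_sum_tendsto \<theta>_small) simp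
  ultimately have eq: "(\<Sum>n. t n) * ?I = qpoch_inf (- ?q) p * ((\<Sum>r. \<theta> r) * ?I\<^sup>2)"
    by (rule LIMSEQ_unique)
  have \<theta>_sum: "(\<Sum>r. \<theta> r) = qpoch_inf (?q ^ 5) (?q ^ 8) * qpoch_inf (?q ^ 3) (?q ^ 8) * qpoch_inf (?q ^ 8) (?q ^ 8)"
    unfolding \<theta>_def by (rule Jacobi_triple_product) (simp_all flip: power_add)
  have "(\<Sum>n. t n) * ?A = ((\<Sum>n. t n) * ?I) * qpoch_inf p p * ?A"
    using I by (simp add: mult.assoc)
  also have "\<dots> = ?I\<^sup>2 * qpoch_inf p p * (qpoch_inf (- ?q) p * (\<Sum>r. \<theta> r) * ?A)"
    unfolding eq by (simp only: mult_ac)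
  also have "qpoch_inf (- ?q) p * (\<Sum>r. \<theta> r) * ?A = qpoch_inf p p"
    unfolding \<theta>_sum p_def by (rule Gollnitz_Gordon_product) simp
  also have "?I\<^sup>2 * qpoch_inf p p * qpoch_inf p p = (?I * qpoch_inf p p)\<^sup>2"
    by (simp add: power2_eq_square mult_ac)
  finally have "(\<Sum>n. t n) * ?A = 1" by (simp add: I)
  moreover have "fps_nth ?A 0 = 1"
    by (simp add: qpoch_inf_nth_0)
  ultimately have "1 \<div> ?A = (\<Sum>n. t n)"
    by (intro fps_quot_unique)
  moreover have "t sums (\<Sum>n. t n)"
    by (rule fps_sums_of_small[OF t_small])
  ultimately show ?thesis by (simp add: t_def p_def)
qed

section \<open>The identity with the parameters w and M\<close>

text \<open>
  Multiplication by \<open>1 - q\<close> cancels the first factor \<open>1 - q^2\<close> of the denominator against the first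
  factor \<open>1 + q\<close> of the numerator.
\<close>

lemma Gollnitz_Gordon_term:
  "(1 - fps_X) * (fps_X ^ ((Suc n)\<^sup>2) * qpoch (- fps_X) (fps_X\<^sup>2) (Suc n) * recip_qpoch (fps_X\<^sup>2) (Suc n)) =
    fps_X ^ ((Suc n)\<^sup>2) * (qpoch (- (fps_X ^ 3)) (fps_X\<^sup>2) n \<div> qpoch (fps_X ^ 4) (fps_X\<^sup>2) n)"
  for n :: nat
proof -
  let ?q = "fps_X :: 'a::comm_ring_1 fps"
  let ?U = "recip_qpoch (?q\<^sup>2) (Suc n)"
  have "qpoch (?q\<^sup>2) (?q\<^sup>2) (Suc n) = (1 - ?q) * (1 + ?q) * qpoch (?q ^ 4) (?q\<^sup>2) n"
    by (simp add: qpoch_Suc_left power2_eq_square power4_eq_xxxx algebra_simps)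
  moreover have "?U * qpoch (?q\<^sup>2) (?q\<^sup>2) (Suc n) = 1"
    by (rule recip_qpoch_mult) simp
  ultimately have U: "?U * ((1 - ?q) * (1 + ?q) * qpoch (?q ^ 4) (?q\<^sup>2) n) = 1"
    by simp
  have q: "qpoch (- ?q) (?q\<^sup>2) (Suc n) = (1 + ?q) * qpoch (- (?q ^ 3)) (?q\<^sup>2) n"
    by (simp add: qpoch_Suc_left power2_eq_square power3_eq_cube mult.assoc)
  have "qpoch (- (?q ^ 3)) (?q\<^sup>2) n \<div> qpoch (?q ^ 4) (?q\<^sup>2) n = (1 - ?q) * qpoch (- ?q) (?q\<^sup>2) (Suc n) * ?U"
  proof (rule fps_quot_unique)
    have "(1 - ?q) * qpoch (- ?q) (?q\<^sup>2) (Suc n) * ?U * qpoch (?q ^ 4) (?q\<^sup>2) n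
        = qpoch (- (?q ^ 3)) (?q\<^sup>2) n * (?U * ((1 - ?q) * (1 + ?q) * qpoch (?q ^ 4) (?q\<^sup>2) n))"
      unfolding q by (simp only: mult_ac)
    then show "(1 - ?q) * qpoch (- ?q) (?q\<^sup>2) (Suc n) * ?U * qpoch (?q ^ 4) (?q\<^sup>2) n
        = qpoch (- (?q ^ 3)) (?q\<^sup>2) n"
      unfolding U by simp
  qed (simp add: qpoch_nth_0)
  then show ?thesis by (simp add: mult_ac)
qed

theorem corollary3p10:
  fixes M :: nat
  assumes "M > 0"
  shows "((1 - q ^ M) \<div> (1 - w * q ^ M)) *
      (1 \<div> (qpoch_inf q (q ^ 8) * qpoch_inf (q ^ 4) (q ^ 8) * qpoch_inf (q ^ 7) (q ^ 8))) =
    (1 + (q * qnum (M - 1) + w * q ^ M) \<div> (1 - w * q ^ M) +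
      (\<Sum>j. q ^ ((j + 2)\<^sup>2) * (qnum M \<div> (1 - w * q ^ M)) *
        (qpoch (- (q ^ 3)) (q\<^sup>2) ((j + 2) - 1) \<div> qpoch (q ^ 4) (q\<^sup>2) ((j + 2) - 1)))
      :: 'a::comm_ring_1 poly fps)"
proof -
  let ?q = "q :: 'a poly fps"
  define D where "D = 1 - w * ?q ^ M"
  define K where "K = 1 \<div> (qpoch_inf ?q (q ^ 8) * qpoch_inf (q ^ 4) (q ^ 8) * qpoch_inf (q ^ 7) (q ^ 8))"
  define t where "t = (\<lambda>n. ?q ^ (n\<^sup>2) * qpoch (- ?q) (?q\<^sup>2) n * recip_qpoch (?q\<^sup>2) n)"
  define c where "c = qnum M * (1 \<div> D)"
  have quot: "f \<div> D = f * (1 \<div> D)" for f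
    by (simp add: fps_quot_def)
  have D: "D * (1 \<div> D) = 1"
    using assms fps_quot_mult[of D 1] by (simp add: D_def mult.commute)
  have qnum: "qnum k * (1 - ?q) = 1 - ?q ^ k" for k
    unfolding qnum_def by (rule fps_quot_mult) simp
  \<comment> \<open>The recursion of \<open>qnum\<close> is proved up to the unit \<open>1 - q\<close>, which is then cancelled.\<close>
  have "(1 - ?q) * (1 + ?q * qnum (M - 1)) = (1 - ?q) * qnum M"
  proof -
    have "(1 - ?q) * (1 + ?q * qnum (M - 1)) = 1 - ?q + ?q * (qnum (M - 1) * (1 - ?q))"
      by (simp add: algebra_simps)
    also have "\<dots> = 1 - ?q * ?q ^ (M - 1)"
      unfolding qnum by (simp add: algebra_simps)
    also have "\<dots> = (1 - ?q) * qnum M"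
      using assms by (simp add: power_eq_if qnum mult.commute[of "1 - ?q"])
    finally show ?thesis .
  qed
  then have "(1 \<div> (1 - ?q)) * (1 - ?q) * (1 + ?q * qnum (M - 1)) = (1 \<div> (1 - ?q)) * (1 - ?q) * qnum M"
    by (simp only: mult.assoc)
  then have qnum_Suc: "1 + ?q * qnum (M - 1) = qnum M"
    by (simp add: fps_quot_mult)
  have K: "t sums K"
    unfolding t_def K_def by (rule Gollnitz_Gordon)
  have t0: "t 0 = 1" by (simp add: t_def)
  have t1: "(1 - ?q) * t 1 = ?q"
    using Gollnitz_Gordon_term[of 0, where 'a = "'a poly"] by (simp add: t_def fps_quot_unique)
  have summand: "?q ^ ((j + 2)\<^sup>2) * (qnum M \<div> D) *
      (qpoch (- (?q ^ 3)) (?q\<^sup>2) ((j + 2) - 1) \<div> qpoch (?q ^ 4) (?q\<^sup>2) ((j + 2) - 1)) =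
      c * (1 - ?q) * t (Suc (Suc j))" for j
    using Gollnitz_Gordon_term[of "Suc j", where 'a = "'a poly"]
    by (simp add: t_def c_def quot[of "qnum M"] mult_ac)
  have "(\<lambda>N. \<Sum>j<N. t (Suc (Suc j))) \<longlonglongrightarrow> K - t 0 - t 1"
  proof -
    have "(\<Sum>j<N. t (Suc (Suc j))) = (\<Sum>j<N + 2. t j) - t 0 - t 1" for N
      by (simp add: sum.lessThan_Suc_shift del: sum.lessThan_Suc)
    moreover have "(\<lambda>N. \<Sum>j<N + 2. t j) \<longlonglongrightarrow> K"
      using K by (intro LIMSEQ_ignore_initial_segment) (simp add: sums_def)
    ultimately show ?thesis
      by (simp only:) (intro tendsto_fps_diff tendsto_const)
  qed
  then have "(\<lambda>N. c * (1 - ?q) * (\<Sum>j<N. t (Suc (Suc j)))) \<longlonglongrightarrow> c * (1 - ?q) * (K - t 0 - t 1)"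
    by (intro tendsto_fps_mult tendsto_const)
  then have "(\<lambda>j. c * (1 - ?q) * t (Suc (Suc j))) sums (c * (1 - ?q) * (K - t 0 - t 1))"
    by (simp add: sums_def sum_distrib_left)
  then have series: "(\<Sum>j. c * (1 - ?q) * t (Suc (Suc j))) = c * (1 - ?q) * (K - t 0 - t 1)"
    by (simp add: sums_iff)
  have "c * (1 - ?q) * (K - t 0 - t 1) = c * ((1 - ?q) * K - 1)"
  proof -
    have "c * (1 - ?q) * (K - t 0 - t 1) = c * ((1 - ?q) * K - (1 - ?q) - (1 - ?q) * t 1)"
      by (simp add: t0 algebra_simps)
    then show ?thesis unfolding t1 by simp
  qed
  also have "\<dots> = (qnum M * (1 - ?q)) * (1 \<div> D) * K - qnum M * (1 \<div> D)"
    by (simp add: c_def algebra_simps)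
  also have "\<dots> = ((1 - ?q ^ M) \<div> D) * K - qnum M * (1 \<div> D)"
    by (simp add: qnum quot[of "1 - ?q ^ M"])
  finally have 1: "c * (1 - ?q) * (K - t 0 - t 1) = ((1 - ?q ^ M) \<div> D) * K - qnum M * (1 \<div> D)" .
  have numerator: "?q * qnum (M - 1) + w * ?q ^ M = qnum M - D"
    unfolding D_def qnum_Suc[symmetric] by simp
  have "(?q * qnum (M - 1) + w * ?q ^ M) \<div> D = (qnum M - D) * (1 \<div> D)"
    unfolding numerator by (rule quot)
  also have "\<dots> = qnum M * (1 \<div> D) - 1"
    using D by (simp add: left_diff_distrib)
  finally show ?thesis
    unfolding D_def[symmetric] K_def[symmetric] summand series 1 by simp
qed

end
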